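(* Let $a$ and $b$ be nonnegative real parameters with $a\neq b$. Let $m$ be a positive integer and let $x\in[a,b]$. Let $k$ and $n$ be nonnegative integers with $n\geq k$ and $n\geq 1$. Then $$\mathbb{Y}_{k}^{n}(x;a,b,m)=\frac{x-a}{b-a}\,\mathbb{Y}_{k-1}^{n-1}(x;a,b,m-1)+\frac{b-x}{b-a}\,\mathbb{Y}_{k}^{n-1}(x;a,b,m-1).$$
   Context: Here $[a,b]=\{x\in\mathbb{R}: a\le x\le b\}$ (so $a<b$). For an integer $m$ and a nonnegative integer $k$, put $$f_{\mathbb{Y},k}(x,t;a,b,m)=\frac{t^{k}(x-a)^{k}e^{(b-x)t}}{(b-a)^{m}\,k!}\qquad(t\in\mathbb{C}),$$ and define $\mathbb{Y}_{k}^{n}(x;a,b,m)$, $n=0,1,2,\dots$, by $$f_{\mathbb{Y},k}(x,t;a,b,m)=\sum_{n=0}^{\infty}\mathbb{Y}_{k}^{n}(x;a,b,m)\frac{t^{n}}{n!}.$$ Thus $\mathbb{Y}_k^n(x;a,b,m)=0$ when $0\le n<k$. Conventions: $\mathbb{Y}_k^n=0$ when $k<0$; $0^0=1$. *)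

theory Defs
  imports Complex_Main
begin

definition fY :: "nat \<Rightarrow> real \<Rightarrow> complex \<Rightarrow> real \<Rightarrow> real \<Rightarrow> int \<Rightarrow> complex" where
  "fY k x t a b m =
     t ^ k * (of_real x - of_real a) ^ k * exp ((of_real b - of_real x) * t) /
     ((of_real b - of_real a) powi m * fact k)"

text \<open>
  The coefficients are real for real parameters, although the generating function is
  expanded in a complex variable. The lower index is an integer because the value is
  by convention 0 when that index is negative.
\<close>

definition Y :: "int \<Rightarrow> nat \<Rightarrow> real \<Rightarrow> real \<Rightarrow> real \<Rightarrow> int \<Rightarrow> real" where
  "Y k n x a b m =
     (if k < 0 then 0
      else (THE c :: nat \<Rightarrow> real.
              \<forall>t :: complex. (\<lambda>j. of_real (c j) * (t ^ j / fact j)) sums fY (nat k) x t a b m) n)"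

end

theory Submission
  imports Defs
begin

text \<open>
  The numbers \<open>Y\<close> are, up to the power of \<open>b - a\<close>, the Bernstein basis functions: multiplying
  the exponential series of \<open>exp ((b - x) * t)\<close> by \<open>(t * (x - a)) ^ k / fact k\<close> and comparing
  with \<open>t ^ n / fact n\<close> turns the factorials into a binomial coefficient
  (\<open>fY_expansion\<close>). A power series that converges on the whole plane determines its
  coefficients (\<open>entire_power_series_coeffs_zero\<close>), so this expansion is the one that
  defines \<open>Y\<close> and gives the closed form \<open>Y_eq_binomial\<close>. The recurrence is then Pascal's
  rule: a factor \<open>(x - a) / (b - a)\<close> is split off the term with \<open>n - 1\<close> over \<open>k - 1\<close>, and
  a factor \<open>(b - x) / (b - a)\<close> off the term with \<open>n - 1\<close> over \<open>k\<close>.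
\<close>

text \<open>
  Evaluating at \<open>0\<close> kills the constant coefficient. For \<open>t \<noteq> 0\<close> a factor \<open>t\<close> can then be
  cancelled, so the shifted series also vanishes away from \<open>0\<close>; by continuity of
  power series it vanishes at \<open>0\<close> too, and induction applies to it.
\<close>

lemma entire_power_series_coeffs_zero:
  fixes d :: "nat \<Rightarrow> complex"
  assumes "\<And>t. (\<lambda>j. d j * t ^ j) sums 0"
  shows "d n = 0"
  using assms
proof (induction n arbitrary: d)
  case 0
  show ?case using "0.prems"[of 0] powser_sums_zero_iff[of d 0] by simp
next
  case (Suc n)
  have d0: "d 0 = 0" using Suc.prems[of 0] powser_sums_zero_iff[of d 0] by simp
  have tail: "(\<lambda>j. d (Suc j) * t ^ j) sums 0" if "t \<noteq> 0" for t
  proof -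
    have "(\<lambda>j. d (Suc j) * t ^ Suc j) sums 0"
      using Suc.prems[of t] d0 sums_Suc_iff[of "\<lambda>j. d j * t ^ j" 0] by simp
    from sums_mult[OF this, of "inverse t"] that show ?thesis
      by (simp add: field_simps)
  qed
  have "((\<lambda>t::complex. 0::complex) \<longlongrightarrow> d (Suc 0)) (at 0)"
    using powser_limit_0_strong[of 1 "\<lambda>j. d (Suc j)" "\<lambda>_. 0"] tail by simp
  then have "d (Suc 0) = 0"
    using tendsto_const_iff[of "at (0::complex)" "0::complex" "d (Suc 0)"] by simp
  then have "(\<lambda>j. d (Suc j) * t ^ j) sums 0" for t
    using tail[of t] powser_sums_zero_iff[of "\<lambda>j. d (Suc j)" 0] by (cases "t = 0") simp_all
  then show ?case by (rule Suc.IH)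
qed

text \<open>
  The first \<open>k\<close> coefficients vanish because the binomial coefficient does, which also makes
  the truncated exponent \<open>j - k\<close> harmless there. From index \<open>k\<close> on, the terms are those of
  the exponential series times a constant.
\<close>

lemma fY_expansion:
  fixes a b x :: real and t :: complex
  shows "(\<lambda>j. of_real (of_nat (j choose k) * (x - a) ^ k * (b - x) ^ (j - k) / (b - a) powi m)
            * (t ^ j / fact j)) sums fY k x t a b m"
proof -
  let ?f = "\<lambda>j. of_real (of_nat (j choose k) * (x - a) ^ k * (b - x) ^ (j - k) / (b - a) powi m)
            * (t ^ j / fact j)"
  let ?v = "of_real (b - x) * t :: complex"
  let ?C = "t ^ k * of_real (x - a) ^ k / (of_real (b - a) powi m * fact k) :: complex"
  have shifted: "?f (i + k) = ?C * (?v ^ i /\<^sub>R fact i)" for i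
  proof -
    define U V P where "U = complex_of_real (x - a)" and "V = complex_of_real (b - x)"
      and "P = complex_of_real (b - a) powi m"
    have "?f (i + k) = of_nat ((i + k) choose k) * U ^ k * V ^ i / P * (t ^ (i + k) / fact (i + k))"
      by (simp add: U_def V_def P_def)
    also have "of_nat ((i + k) choose k) = (fact (i + k) / (fact k * fact i) :: complex)"
      using binomial_fact[of k "i + k", where 'a = complex] by simp
    also have "fact (i + k) / (fact k * fact i) * U ^ k * V ^ i / P * (t ^ (i + k) / fact (i + k))
        = t ^ k * U ^ k / (P * fact k) * (V ^ i * t ^ i / fact i)"
      by (simp add: power_add mult_ac)
    also have "V ^ i * t ^ i / fact i = ?v ^ i /\<^sub>R fact i"
      by (simp add: V_def power_mult_distrib scaleR_conv_of_real divide_inverse mult.commute)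
    finally show ?thesis by (simp only: U_def P_def)
  qed
  have "(\<lambda>i. ?f (i + k)) sums (?C * exp ?v)"
    unfolding shifted by (intro sums_mult exp_converges)
  moreover have "?f j = 0" if "j < k" for j using that by simp
  ultimately have "?f sums (?C * exp ?v)" using sums_zero_iff_shift[of k ?f] by blast
  then show ?thesis by (simp add: fY_def)
qed

text \<open>
  The definite description in the definition of \<open>Y\<close> is resolved by existence and uniqueness of
  the expansion; the difference of two expansions is a power series with sum zero everywhere.
\<close>

lemma Y_eq_binomial:
  "Y (int k) n x a b m =
     of_nat (n choose k) * (x - a) ^ k * (b - x) ^ (n - k) / (b - a) powi m"
proof -
  let ?c = "\<lambda>j. of_nat (j choose k) * (x - a) ^ k * (b - x) ^ (j - k) / (b - a) powi m"
  have "(THE c :: nat \<Rightarrow> real.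
           \<forall>t :: complex. (\<lambda>j. of_real (c j) * (t ^ j / fact j)) sums fY k x t a b m) = ?c"
  proof (rule the_equality)
    show "\<forall>t. (\<lambda>j. of_real (?c j) * (t ^ j / fact j)) sums fY k x t a b m"
      using fY_expansion by blast
  next
    fix c :: "nat \<Rightarrow> real"
    assume c: "\<forall>t :: complex. (\<lambda>j. of_real (c j) * (t ^ j / fact j)) sums fY k x t a b m"
    show "c = ?c"
    proof
      fix j
      have "(\<lambda>j. of_real (c j - ?c j) / fact j * t ^ j) sums 0" for t :: complex
        using sums_diff[OF c[rule_format, of t] fY_expansion[of k x a b m t]]
        by (simp add: algebra_simps diff_divide_distrib)
      then have "of_real (c j - ?c j) / fact j = (0 :: complex)"
        by (rule entire_power_series_coeffs_zero)
      then have "complex_of_real (c j - ?c j) = 0"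
        by (simp only: divide_eq_0_iff fact_nonzero simp_thms)
      then show "c j = ?c j"
        by (simp only: of_real_eq_0_iff right_minus_eq)
    qed
  qed
  then show ?thesis by (simp add: Y_def)
qed

theorem corollary2:
  fixes a b x :: real and m :: int and k n :: nat
  assumes "a \<ge> 0" and "b \<ge> 0" and "a \<noteq> b"
    and "m > 0"
    and "x \<in> {a..b}"
    and "n \<ge> k" and "n \<ge> 1"
  shows "Y (int k) n x a b m =
           (x - a) / (b - a) * Y (int k - 1) (n - 1) x a b (m - 1)
         + (b - x) / (b - a) * Y (int k) (n - 1) x a b (m - 1)"
proof -
  obtain N where n: "n = Suc N" using \<open>n \<ge> 1\<close> by (cases n) auto
  have powi: "(b - a) powi m = (b - a) * (b - a) powi (m - 1)"
    using \<open>a \<noteq> b\<close> by (simp add: power_int_diff)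
  show ?thesis
  proof (cases k)
    case 0
    have "Y (int k - 1) (n - 1) x a b (m - 1) = 0" using 0 by (simp add: Y_def)
    then show ?thesis using Y_eq_binomial[of 0] 0 by (simp add: powi n)
  next
    case (Suc K)
    have lower: "int k - 1 = int K" using Suc by simp
    \<comment> \<open>At \<open>N = K\<close> the truncated exponents disagree, but the binomial coefficient is zero.\<close>
    have step: "real (N choose Suc K) * (b - x) ^ (N - K)
        = real (N choose Suc K) * ((b - x) * (b - x) ^ (N - Suc K))"
    proof (cases "K < N")
      case True
      then have "N - K = Suc (N - Suc K)" by simp
      then show ?thesis by simp
    next
      case False
      then show ?thesis by simp
    qed
    have "Y (int k) n x a b m
        = (real (N choose K) * (b - x) ^ (N - K) + real (N choose Suc K) * (b - x) ^ (N - K))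
            * (x - a) ^ Suc K / ((b - a) * (b - a) powi (m - 1))"
      by (simp add: Y_eq_binomial powi n Suc algebra_simps del: of_nat_Suc)
    also have "\<dots> = (x - a) / (b - a)
            * (real (N choose K) * (x - a) ^ K * (b - x) ^ (N - K) / (b - a) powi (m - 1))
        + (b - x) / (b - a)
            * (real (N choose Suc K) * (x - a) ^ Suc K * (b - x) ^ (N - Suc K) / (b - a) powi (m - 1))"
      unfolding step by (simp add: add_divide_distrib distrib_right distrib_left mult_ac)
    finally show ?thesis
      unfolding lower by (simp only: Y_eq_binomial n Suc diff_Suc_1)
  qed
qed

end
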